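(* Let $r$ be an odd integer and let $n$ be a positive integer. Then \[ L_{3r}\sum_{k=1}^n F_{2rk}^3= \begin{cases} F_{rn}L_{rn+r}\left(L_{rn}F_{rn+r}F_{2rn+r}-2F_r^2\right) & \text{if $n$ is even,}\\ L_{rn}F_{rn+r}\left(F_{rn}L_{rn+r}F_{2rn+r}-2F_r^2\right) & \text{if $n$ is odd.} \end{cases} \]
   Context: The Fibonacci numbers $F_m$ and Lucas numbers $L_m$ are defined for all $m\in\mathbb{Z}$ by $F_m=F_{m-1}+F_{m-2}$, $F_0=0$, $F_1=1$, and $L_m=L_{m-1}+L_{m-2}$, $L_0=2$, $L_1=1$; in particular $F_{-m}=(-1)^{m-1}F_m$ and $L_{-m}=(-1)^mL_m$. *)

theory Defs
  imports "HOL-Number_Theory.Fib"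
begin

(* Both sequences are indexed by all integers. The recurrence x m = x (m - 1) + x (m - 2) is used
   as it stands for m > 1 and is solved for its last term when m < 0; the unconditional
   recurrences are fib_int_rec and lucas_int_rec below. *)

function fib_int :: "int \<Rightarrow> int" where
  "fib_int m =
    (if m = 0 then 0
     else if m = 1 then 1
     else if m > 1 then fib_int (m - 1) + fib_int (m - 2)
     else fib_int (m + 2) - fib_int (m + 1))"
  by pat_completeness auto
termination by (relation "measure (\<lambda>m. nat \<bar>2 * m - 1\<bar>)") auto

function lucas_int :: "int \<Rightarrow> int" where
  "lucas_int m =
    (if m = 0 then 2
     else if m = 1 then 1
     else if m > 1 then lucas_int (m - 1) + lucas_int (m - 2)
     else lucas_int (m + 2) - lucas_int (m + 1))"
  by pat_completeness auto
termination by (relation "measure (\<lambda>m. nat \<bar>2 * m - 1\<bar>)") auto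

declare fib_int.simps [simp del] lucas_int.simps [simp del]

lemma fib_int_0 [simp]: "fib_int 0 = 0"
  and fib_int_1 [simp]: "fib_int 1 = 1"
  by (simp_all add: fib_int.simps)

lemma lucas_int_0 [simp]: "lucas_int 0 = 2"
  and lucas_int_1 [simp]: "lucas_int 1 = 1"
  by (simp_all add: lucas_int.simps)

lemma fib_int_rec: "fib_int m = fib_int (m - 1) + fib_int (m - 2)"
proof (cases "m > 1")
  case True
  then show ?thesis by (subst fib_int.simps) simp
next
  case False
  then have "fib_int (m - 2) = fib_int (m - 2 + 2) - fib_int (m - 2 + 1)"
    by (subst fib_int.simps) simp
  then show ?thesis by simp
qed

lemma lucas_int_rec: "lucas_int m = lucas_int (m - 1) + lucas_int (m - 2)"
proof (cases "m > 1")
  case True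
  then show ?thesis by (subst lucas_int.simps) simp
next
  case False
  then have "lucas_int (m - 2) = lucas_int (m - 2 + 2) - lucas_int (m - 2 + 1)"
    by (subst lucas_int.simps) simp
  then show ?thesis by simp
qed

lemma fib_int_of_nat: "fib_int (int n) = int (fib n)"
proof (induction n rule: fib.induct)
  case (3 n)
  then show ?case
    using fib_int_rec [of "int (Suc (Suc n))"] by (simp add: algebra_simps)
qed simp_all

lemma fib_int_neg_of_nat: "fib_int (- int n) = (- 1) ^ (n + 1) * fib_int (int n)"
proof (induction n rule: fib.induct)
  case 2
  show ?case using fib_int_rec [of 1] by simp
next
  case (3 n)
  have "- int n - 1 = - 1 - int n" by simp
  with 3 show ?case
    using fib_int_rec [of "int (Suc (Suc n))"] fib_int_rec [of "- int n"]
    by (simp add: algebra_simps)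
qed simp_all

lemma lucas_int_neg_of_nat: "lucas_int (- int n) = (- 1) ^ n * lucas_int (int n)"
proof (induction n rule: fib.induct)
  case 2
  show ?case using lucas_int_rec [of 1] by simp
next
  case (3 n)
  have "- int n - 1 = - 1 - int n" by simp
  with 3 show ?case
    using lucas_int_rec [of "int (Suc (Suc n))"] lucas_int_rec [of "- int n"]
    by (simp add: algebra_simps)
qed simp_all

end

theory Submission
  imports Defs
begin

text \<open>
  Write \<open>f = F\<^sub>r\<close>, \<open>l = L\<^sub>r\<close> and \<open>X\<^sub>n = F\<^bsub>2rn+r\<^esub>\<close>. Two observations give the formula.

  First, both cases of the right-hand side are the same polynomial in \<open>X\<^sub>n\<close>. The products
  \<open>F\<^bsub>rn\<^esub> L\<^bsub>rn+r\<^esub>\<close> and \<open>L\<^bsub>rn\<^esub> F\<^bsub>rn+r\<^esub>\<close> have sum \<open>2 X\<^sub>n\<close> by the addition formula and differ by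
  \<open>2f\<close>, with a sign that depends on the parity of \<open>rn\<close>, that is, of \<open>n\<close>
  (\<open>lucas_fib_cross_difference\<close>). In either case the outer product is \<open>X\<^sub>n - f\<close> and the inner
  one is \<open>X\<^sub>n + f\<close>, so the right-hand side is
  \<open>(X\<^sub>n - f) ((X\<^sub>n + f) X\<^sub>n - 2f\<^sup>2) = X\<^sub>n\<^sup>3 - 3f\<^sup>2X\<^sub>n + 2f\<^sup>3\<close>.

  Second, this cubic telescopes. It vanishes at \<open>n = 0\<close>, where \<open>X\<^sub>0 = f\<close>. Put \<open>a = 2rn\<close>; as \<open>a\<close> is
  even and \<open>r\<close> is odd, \<open>X\<^sub>n\<close> and \<open>X\<^bsub>n-1\<^esub>\<close> are \<open>(L\<^sub>a f \<plusminus> F\<^sub>a l) / 2\<close>, and the norm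
  equations \<open>L\<^sub>a\<^sup>2 = 5F\<^sub>a\<^sup>2 + 4\<close> and \<open>l\<^sup>2 = 5f\<^sup>2 - 4\<close> turn the increment of the cubic into
  \<open>l (l\<^sup>2 + 3) F\<^sub>a\<^sup>3 = L\<^bsub>3r\<^esub> F\<^sub>a\<^sup>3\<close> (\<open>fib_cubic_increment\<close>).

  The identities used are the components of the multiplication and norm laws for the powers
  \<open>((1 + \<surd>5) / 2)\<^sup>m = (L\<^sub>m + F\<^sub>m \<surd>5) / 2\<close>, read in integers.
\<close>

section \<open>Addition formulas and norm equation\<close>

lemma fib_int_add_2: "fib_int (m + 2) = fib_int (m + 1) + fib_int m"
  using fib_int_rec [of "m + 2"] by (simp add: add.commute)

lemma lucas_int_add_2: "lucas_int (m + 2) = lucas_int (m + 1) + lucas_int m"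
  using lucas_int_rec [of "m + 2"] by (simp add: add.commute)

text \<open>
  The recurrence can be run in both directions, so two consecutive values determine a solution on
  all of the integers. Identities that are linear in a sequence reduce to a check at 0 and 1.
\<close>

lemma fibonacci_recurrence_unique:
  fixes g h :: "int \<Rightarrow> int"
  assumes g: "\<And>m. g (m + 2) = g (m + 1) + g m"
    and h: "\<And>m. h (m + 2) = h (m + 1) + h m"
    and eq0: "g 0 = h 0" and eq1: "g 1 = h 1"
  shows "g m = h m"
proof -
  have "g m = h m \<and> g (m + 1) = h (m + 1)"
  proof (induction m rule: int_induct [where k = 0])
    case base
    show ?case using eq0 eq1 by simp
  next
    case (step1 i)
    then show ?case using g [of i] h [of i] by (simp add: add.assoc)
  next
    case (step2 i)
    then show ?case using g [of "i - 1"] h [of "i - 1"] by (simp add: add.commute)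
  qed
  then show ?thesis ..
qed

lemma lucas_int_conv_fib_int: "lucas_int m = 2 * fib_int (m + 1) - fib_int m"
proof (rule fibonacci_recurrence_unique [where g = lucas_int])
  fix m :: int
  show "2 * fib_int (m + 2 + 1) - fib_int (m + 2) =
    2 * fib_int (m + 1 + 1) - fib_int (m + 1) + (2 * fib_int (m + 1) - fib_int m)"
    using fib_int_add_2 [of m] fib_int_add_2 [of "m + 1"] by (simp add: add.assoc add.commute)
qed (use fib_int_add_2 [of 0] in \<open>simp_all add: lucas_int_add_2\<close>)

lemma fib_int_Suc: "2 * fib_int (m + 1) = fib_int m + lucas_int m"
  by (simp add: lucas_int_conv_fib_int)

lemma lucas_int_Suc: "2 * lucas_int (m + 1) = lucas_int m + 5 * fib_int m"
  using fib_int_add_2 [of m] by (simp add: lucas_int_conv_fib_int add.assoc)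

lemma fib_int_add: "2 * fib_int (a + b) = fib_int a * lucas_int b + lucas_int a * fib_int b"
proof (rule fibonacci_recurrence_unique
    [where g = "\<lambda>b. 2 * fib_int (a + b)"
       and h = "\<lambda>b. fib_int a * lucas_int b + lucas_int a * fib_int b"])
  fix m :: int
  show "2 * fib_int (a + (m + 2)) = 2 * fib_int (a + (m + 1)) + 2 * fib_int (a + m)"
    using fib_int_add_2 [of "a + m"] by (simp add: add.assoc)
qed (simp_all add: fib_int_add_2 lucas_int_add_2 fib_int_Suc distrib_left distrib_right)

lemma lucas_int_add: "2 * lucas_int (a + b) = lucas_int a * lucas_int b + 5 * fib_int a * fib_int b"
proof (rule fibonacci_recurrence_unique
    [where g = "\<lambda>b. 2 * lucas_int (a + b)"
       and h = "\<lambda>b. lucas_int a * lucas_int b + 5 * fib_int a * fib_int b"])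
  fix m :: int
  show "2 * lucas_int (a + (m + 2)) = 2 * lucas_int (a + (m + 1)) + 2 * lucas_int (a + m)"
    using lucas_int_add_2 [of "a + m"] by (simp add: add.assoc)
qed (simp_all add: fib_int_add_2 lucas_int_add_2 lucas_int_Suc distrib_left distrib_right)

text \<open>
  This is four times the norm of the \<open>m\<close>-th power of the golden ratio, a unit of norm \<open>-1\<close>, so the
  sign alternates.
\<close>

lemma lucas_fib_norm: "lucas_int m ^ 2 - 5 * fib_int m ^ 2 = (if even m then 4 else - 4)"
proof -
  have step: "lucas_int (m + 1) ^ 2 - 5 * fib_int (m + 1) ^ 2 =
      - (lucas_int m ^ 2 - 5 * fib_int m ^ 2)" for m
  proof -
    have "4 * (lucas_int (m + 1) ^ 2 - 5 * fib_int (m + 1) ^ 2) =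
        (2 * lucas_int (m + 1)) ^ 2 - 5 * (2 * fib_int (m + 1)) ^ 2"
      by (simp add: power_mult_distrib)
    also have "\<dots> = - 4 * (lucas_int m ^ 2 - 5 * fib_int m ^ 2)"
      unfolding fib_int_Suc lucas_int_Suc by algebra
    finally show ?thesis by simp
  qed
  show ?thesis
  proof (induction m rule: int_induct [where k = 0])
    case (step1 i)
    then show ?case using step [of i] by simp
  next
    case (step2 i)
    then show ?case using step [of "i - 1"] by (auto split: if_splits)
  qed simp
qed

text \<open>
  Expanding the left-hand side by the addition formulas leaves \<open>F\<^sub>b\<close> times the norm at \<open>a\<close>.
  Together with \<open>fib_int_add\<close> this evaluates the two mixed products separately.
\<close>

lemma lucas_fib_cross_difference:
  "lucas_int a * fib_int (a + b) - fib_int a * lucas_int (a + b) =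
    (if even a then 2 else - 2) * fib_int b"
proof -
  have "2 * (lucas_int a * fib_int (a + b) - fib_int a * lucas_int (a + b)) =
      lucas_int a * (2 * fib_int (a + b)) - fib_int a * (2 * lucas_int (a + b))"
    by (simp add: algebra_simps)
  also have "\<dots> = (lucas_int a ^ 2 - 5 * fib_int a ^ 2) * fib_int b"
    unfolding fib_int_add lucas_int_add by algebra
  also have "\<dots> = 2 * ((if even a then 2 else - 2) * fib_int b)"
    by (simp add: lucas_fib_norm)
  finally show ?thesis by simp
qed

section \<open>Odd steps\<close>

text \<open>Cubing \<open>(l + f \<surd>5) / 2\<close> and eliminating \<open>5f\<^sup>2 = l\<^sup>2 + 4\<close> gives a polynomial in \<open>l\<close> alone.\<close>

lemma lucas_int_triple_odd:
  assumes "odd r"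
  shows "lucas_int (3 * r) = lucas_int r * (lucas_int r ^ 2 + 3)"
proof -
  have norm: "5 * fib_int r ^ 2 = lucas_int r ^ 2 + 4"
    using lucas_fib_norm [of r] assms by simp
  have "4 * lucas_int (3 * r) = 2 * (2 * lucas_int (r + (r + r)))"
    by (simp add: algebra_simps)
  also have "\<dots> = lucas_int r * (2 * lucas_int (r + r)) + 5 * fib_int r * (2 * fib_int (r + r))"
    unfolding lucas_int_add [of r "r + r"] by (simp add: algebra_simps)
  also have "\<dots> = lucas_int r * (lucas_int r ^ 2 + 3 * (5 * fib_int r ^ 2))"
    unfolding fib_int_add lucas_int_add by algebra
  also have "\<dots> = 4 * (lucas_int r * (lucas_int r ^ 2 + 3))"
    unfolding norm by (simp add: algebra_simps)
  finally show ?thesis by simp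
qed

text \<open>
  Read at \<open>a = (a - r) + r\<close>, the two addition formulas are a linear system for the values at
  \<open>a - r\<close>. Its determinant is the norm at \<open>r\<close>, which is \<open>-4\<close> because \<open>r\<close> is odd.
\<close>

lemma fib_int_diff_odd:
  assumes "odd r"
  shows "2 * fib_int (a - r) = lucas_int a * fib_int r - fib_int a * lucas_int r"
proof -
  have norm: "lucas_int r ^ 2 - 5 * fib_int r ^ 2 = - 4"
    using lucas_fib_norm [of r] assms by simp
  have F: "2 * fib_int a = fib_int (a - r) * lucas_int r + lucas_int (a - r) * fib_int r"
    and L: "2 * lucas_int a = lucas_int (a - r) * lucas_int r + 5 * fib_int (a - r) * fib_int r"
    using fib_int_add [of "a - r" r] lucas_int_add [of "a - r" r] by simp_all
  have "2 * (lucas_int a * fib_int r - fib_int a * lucas_int r) =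
      (2 * lucas_int a) * fib_int r - (2 * fib_int a) * lucas_int r"
    by (simp add: algebra_simps)
  also have "\<dots> = - (lucas_int r ^ 2 - 5 * fib_int r ^ 2) * fib_int (a - r)"
    unfolding F L by algebra
  also have "\<dots> = 4 * fib_int (a - r)"
    unfolding norm by simp
  finally show ?thesis by simp
qed

text \<open>
  With \<open>X, Y = (L\<^sub>a f \<plusminus> F\<^sub>a l) / 2\<close>, the difference \<open>X - Y = F\<^sub>a l\<close> factors out of the increment, and
  the norm equation at \<open>a\<close> makes the term \<open>3f\<^sup>2\<close> cancel in the remaining factor
  \<open>X\<^sup>2 + X Y + Y\<^sup>2 - 3f\<^sup>2\<close>. That cancellation dictates the coefficient of the linear term.
\<close>

lemma fib_cubic_increment:
  assumes "odd r" and "even a"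
  shows "(fib_int (a + r) ^ 3 - 3 * fib_int r ^ 2 * fib_int (a + r))
       - (fib_int (a - r) ^ 3 - 3 * fib_int r ^ 2 * fib_int (a - r))
       = lucas_int (3 * r) * fib_int a ^ 3"
proof -
  define X Y A B f l where defs: "X = fib_int (a + r)" "Y = fib_int (a - r)"
    "A = fib_int a" "B = lucas_int a" "f = fib_int r" "l = lucas_int r"
  have X: "2 * X = A * l + B * f"
    unfolding defs by (rule fib_int_add)
  have Y: "2 * Y = B * f - A * l"
    unfolding defs using assms(1) by (rule fib_int_diff_odd)
  have norm_a: "B ^ 2 = 5 * A ^ 2 + 4"
    unfolding defs using lucas_fib_norm [of a] assms(2) by simp
  have norm_r: "5 * f ^ 2 = l ^ 2 + 4"
    unfolding defs using lucas_fib_norm [of r] assms(1) by simp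
  have diff: "X - Y = A * l"
    using X Y by simp
  have "4 * (X ^ 2 + X * Y + Y ^ 2 - 3 * f ^ 2) =
      (2 * X) ^ 2 + (2 * X) * (2 * Y) + (2 * Y) ^ 2 - 12 * f ^ 2"
    by (simp add: power_mult_distrib)
  also have "\<dots> = 3 * B ^ 2 * f ^ 2 + A ^ 2 * l ^ 2 - 12 * f ^ 2"
    unfolding X Y by algebra
  also have "\<dots> = A ^ 2 * (3 * (5 * f ^ 2) + l ^ 2)"
    unfolding norm_a by algebra
  also have "\<dots> = 4 * (A ^ 2 * (l ^ 2 + 3))"
    unfolding norm_r by (simp add: algebra_simps)
  finally have quad: "X ^ 2 + X * Y + Y ^ 2 - 3 * f ^ 2 = A ^ 2 * (l ^ 2 + 3)"
    by simp
  have "(X ^ 3 - 3 * f ^ 2 * X) - (Y ^ 3 - 3 * f ^ 2 * Y) =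
      (X - Y) * (X ^ 2 + X * Y + Y ^ 2 - 3 * f ^ 2)"
    by algebra
  also have "\<dots> = l * (l ^ 2 + 3) * A ^ 3"
    unfolding diff quad by algebra
  finally show ?thesis
    unfolding lucas_int_triple_odd [OF assms(1)] defs .
qed

section \<open>The sum of cubes\<close>

text \<open>Telescoping; the constant term \<open>2f\<^sup>3\<close> makes the cubic vanish for the empty sum.\<close>

lemma sum_fib_cubes_odd:
  assumes "odd r"
  shows "lucas_int (3 * r) * (\<Sum>k=1..n. fib_int (2 * r * int k) ^ 3) =
    fib_int (2 * r * int n + r) ^ 3 - 3 * fib_int r ^ 2 * fib_int (2 * r * int n + r)
      + 2 * fib_int r ^ 3"
proof (induction n)
  case 0
  show ?case by (simp add: power3_eq_cube power2_eq_square)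
next
  case (Suc n)
  have shift: "2 * r * int (Suc n) - r = 2 * r * int n + r"
    by (simp add: algebra_simps)
  have "even (2 * r * int (Suc n))"
    by simp
  from fib_cubic_increment [OF assms this] Suc show ?case
    unfolding shift by (simp add: distrib_left)
qed

theorem theorem3p1:
  fixes r :: int and n :: nat
  assumes "odd r" and "n > 0"
  shows "lucas_int (3 * r) * (\<Sum>k=1..n. fib_int (2 * r * int k) ^ 3) =
    (if even n then
       fib_int (r * int n) * lucas_int (r * int n + r) *
         (lucas_int (r * int n) * fib_int (r * int n + r) * fib_int (2 * r * int n + r)
           - 2 * fib_int r ^ 2)
     else
       lucas_int (r * int n) * fib_int (r * int n + r) *
         (fib_int (r * int n) * lucas_int (r * int n + r) * fib_int (2 * r * int n + r)
           - 2 * fib_int r ^ 2))"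
proof -
  define X f P Q where defs: "X = fib_int (2 * r * int n + r)" "f = fib_int r"
    "P = fib_int (r * int n) * lucas_int (r * int n + r)"
    "Q = lucas_int (r * int n) * fib_int (r * int n + r)"
  have "r * int n + (r * int n + r) = 2 * r * int n + r"
    by (simp add: algebra_simps)
  then have sum: "P + Q = 2 * X"
    using fib_int_add [of "r * int n" "r * int n + r"] unfolding defs by (simp only:)
  have difference: "Q - P = (if even n then 2 else - 2) * f"
    using lucas_fib_cross_difference [of "r * int n" r] assms(1) unfolding defs by simp
  have cubic: "X ^ 3 - 3 * f ^ 2 * X + 2 * f ^ 3 = (X - f) * ((X + f) * X - 2 * f ^ 2)"
    by algebra
  have "X ^ 3 - 3 * f ^ 2 * X + 2 * f ^ 3 =
      (if even n then P * (Q * X - 2 * f ^ 2) else Q * (P * X - 2 * f ^ 2))"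
  proof (cases "even n")
    case True
    with sum difference have "P = X - f" "Q = X + f" by simp_all
    with True cubic show ?thesis by simp
  next
    case False
    with sum difference have "P = X + f" "Q = X - f" by simp_all
    with False cubic show ?thesis by simp
  qed
  then show ?thesis
    unfolding sum_fib_cubes_odd [OF assms(1)] defs .
qed

end
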